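(* Let $\kappa$ be a positive integer, finite or infinite, and let $A$ be a nonempty subset of $[1..\kappa]$. Then there is an integer $\mu\in[1..\kappa]$ such that $\mu\in A$ and $\mu\le n$ for every $n\in A$ (the smallest element, denoted $\min A$).
   Context: We work in Sergeyev's numeral system, which contains the standard numerals for finite integers together with the symbol ① (grossone), defined as the number of elements of the set of natural numbers, with $n<$ ① for every finite positive integer $n$; positive integers may be finite or infinite, possibly larger than ①. For a number $\mu$, $[1..\mu]$ denotes the set of integers $k$ with $1\le k\le\mu$. A subset $S$ of $[1..\kappa]$ is an initial segment if $1\in S$ and $y\in S$ whenever $x\in S$ and $y<x$. Axiom: for each positive integer $\kappa$ and each initial segment $S$ of $[1..\kappa]$, there is a number $\sigma\le\kappa$ with $S=[1..\sigma]$.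
   Formalization: "Subset" here means a set of the system: a family closed under first-order definition within each [1..κ], for which the axiom holds. For arbitrary subsets the axiom is inconsistent: the finite positive integers form an initial segment of [1..①] that is not of the form [1..σ]. *)

theory Defs
  imports Main
begin

text \<open>
  The integers of the numeral system, finite and infinite, form a discretely ordered integral
  domain \<open>'a\<close>. The finite ones are the values of \<open>of_int\<close>. For a positive integer \<open>\<mu>\<close>, the set
  \<open>[1..\<mu>]\<close> is \<open>{1..\<mu>}\<close>.

  A set of the system cannot be an arbitrary subset of \<open>'a\<close>: if all subsets were sets, then
  the finite positive integers would be an initial segment of \<open>[1..\<kappa>]\<close> for every infinite \<open>\<kappa>\<close>,
  and the axiom on initial segments would be contradictory (see \<open>finite_not_set\<close> below). So the
  sets are given by a family \<open>Sets\<close>, as in Henkin semantics, which contains at least every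
  collection of elements of some \<open>[1..\<kappa>]\<close> that is described by a formula of first-order
  arithmetic, where the formula may mention arbitrary integers and arbitrary sets of the system.
\<close>

datatype trm = Var nat | One | Plus trm trm | Minus trm trm | Times trm trm

datatype fm =
    Eq trm trm
  | Less trm trm
  | Mem trm nat  \<comment> \<open>membership in the set denoted by a set variable\<close>
  | Neg fm
  | Conj fm fm
  | All nat fm  \<comment> \<open>quantification over all integers; there is none over sets\<close>

primrec trm_val :: "(nat \<Rightarrow> 'a::linordered_idom) \<Rightarrow> trm \<Rightarrow> 'a" where
  "trm_val \<nu> (Var i) = \<nu> i"
| "trm_val \<nu> One = 1"
| "trm_val \<nu> (Plus s t) = trm_val \<nu> s + trm_val \<nu> t"
| "trm_val \<nu> (Minus s t) = trm_val \<nu> s - trm_val \<nu> t"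
| "trm_val \<nu> (Times s t) = trm_val \<nu> s * trm_val \<nu> t"

primrec holds :: "(nat \<Rightarrow> 'a set) \<Rightarrow> (nat \<Rightarrow> 'a::linordered_idom) \<Rightarrow> fm \<Rightarrow> bool" where
  "holds \<Xi> \<nu> (Eq s t) \<longleftrightarrow> trm_val \<nu> s = trm_val \<nu> t"
| "holds \<Xi> \<nu> (Less s t) \<longleftrightarrow> trm_val \<nu> s < trm_val \<nu> t"
| "holds \<Xi> \<nu> (Mem t j) \<longleftrightarrow> trm_val \<nu> t \<in> \<Xi> j"
| "holds \<Xi> \<nu> (Neg \<phi>) \<longleftrightarrow> \<not> holds \<Xi> \<nu> \<phi>"
| "holds \<Xi> \<nu> (Conj \<phi> \<psi>) \<longleftrightarrow> holds \<Xi> \<nu> \<phi> \<and> holds \<Xi> \<nu> \<psi>"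
| "holds \<Xi> \<nu> (All i \<phi>) \<longleftrightarrow> (\<forall>x. holds \<Xi> (\<nu>(i := x)) \<phi>)"

text \<open>The bound \<open>1 \<le> y\<close> is needed because \<open>'a\<close> also contains \<open>0\<close> and the negative integers.\<close>

definition initial_segment :: "'a::linordered_idom \<Rightarrow> 'a set \<Rightarrow> bool" where
  "initial_segment \<kappa> S \<longleftrightarrow>
     S \<subseteq> {1..\<kappa>} \<and> 1 \<in> S \<and> (\<forall>x\<in>S. \<forall>y. 1 \<le> y \<and> y < x \<longrightarrow> y \<in> S)"

locale grossone_system =
  fixes Sets :: "'a::{linordered_idom, discrete_linordered_semidom} set set"
    and grossone :: 'a
  assumes separation:
      "\<And>\<kappa> \<phi> i \<Xi> \<nu>. 0 < \<kappa> \<Longrightarrow> range \<Xi> \<subseteq> Sets \<Longrightarrow> {k \<in> {1..\<kappa>}. holds \<Xi> (\<nu>(i := k)) \<phi>} \<in> Sets"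
    and initial_segment_axiom:
      "\<And>\<kappa> S. 0 < \<kappa> \<Longrightarrow> S \<in> Sets \<Longrightarrow> initial_segment \<kappa> S \<Longrightarrow> \<exists>\<sigma>\<le>\<kappa>. S = {1..\<sigma>}"
    and finite_less_grossone: "\<And>n::nat. of_nat n < grossone"
begin

text \<open>
  The set of natural numbers of the system; it has infinite elements too, and \<open>grossone\<close> is the
  number of its elements, counted by the identity enumeration \<open>1, 2, \<dots>, grossone\<close>.
\<close>

definition Naturals :: "'a set" where
  "Naturals = {1..grossone}"

lemma finite_not_set: "{of_nat n |n::nat. 1 \<le> n} \<notin> Sets"
proof
  let ?F = "{of_nat n |n::nat. 1 \<le> n} :: 'a set"
  assume F: "?F \<in> Sets"
  have below: "\<exists>m::nat. y = of_nat m \<and> 1 \<le> m" if "1 \<le> y" "y < of_nat n" for y :: 'a and n :: nat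
    using that
  proof (induction n)
    case 0
    then show ?case
      using zero_less_one[where 'a = 'a] by (auto dest: order.strict_trans1 order.strict_trans)
  next
    case (Suc n)
    then have "y \<le> of_nat n"
      using less_iff_succ_less_eq[of y "of_nat (Suc n)"] by simp
    with Suc show ?case
      by (cases "y = of_nat n") (auto intro!: exI[of _ n] simp: Suc_le_eq intro: gr0I)
  qed
  have "initial_segment grossone ?F"
    unfolding initial_segment_def
  proof (intro conjI ballI allI impI)
    show "?F \<subseteq> {1..grossone}"
      by (auto intro: less_imp_le[OF finite_less_grossone])
    show "1 \<in> ?F"
      by (auto intro!: exI[of _ "1::nat"])
    show "y \<in> ?F" if "x \<in> ?F" "1 \<le> y \<and> y < x" for x y
      using below that by blast
  qed
  moreover have "0 < grossone"
    using finite_less_grossone[of 0] by simp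
  ultimately obtain \<sigma> where \<sigma>: "?F = {1..\<sigma>}"
    using initial_segment_axiom F by blast
  have "1 \<in> ?F"
    by (auto intro!: exI[of _ "1::nat"])
  then have "\<sigma> \<in> ?F"
    unfolding \<sigma> by simp
  then obtain n :: nat where n: "\<sigma> = of_nat n"
    by blast
  have "of_nat (Suc n) \<in> ?F"
    by (intro CollectI exI[of _ "Suc n"]) simp
  then show False
    unfolding \<sigma> n by simp
qed

end

end

theory Submission
  imports Defs
begin

text \<open>
  The lower bounds of \<open>A\<close> in \<open>[1..\<kappa>]\<close> form an initial segment \<open>[1..\<sigma>]\<close>. If \<open>\<sigma>\<close> were not in \<open>A\<close>,
  then \<open>\<sigma> + 1\<close> would be a lower bound as well; so \<open>\<sigma>\<close> is the minimum.
\<close>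

text \<open>The initial segment axiom speaks only of members of \<open>Sets\<close>. Being a lower
  bound of \<open>A\<close> is a first-order condition with \<open>A\<close> as parameter, so
  separation applies.\<close>

lemma (in grossone_system) lower_bounds_in_Sets:
  assumes "0 < \<kappa>" and "A \<in> Sets"
  shows "{k \<in> {1..\<kappa>}. \<forall>n\<in>A. k \<le> n} \<in> Sets"
proof -
  \<comment> \<open>Variable 0 is the candidate \<open>k\<close>, variable 1 ranges over the
    integers, and every set variable denotes \<open>A\<close>.\<close>
  let ?\<phi> = "All 1 (Neg (Conj (Mem (Var 1) 0) (Less (Var 1) (Var 0))))"
  have "{k \<in> {1..\<kappa>}. holds (\<lambda>_. A) ((\<lambda>_. 0)(0 := k)) ?\<phi>} \<in> Sets"
    using assms by (intro separation) auto
  moreover have "holds (\<lambda>_. A) ((\<lambda>_. 0)(0 := k)) ?\<phi> \<longleftrightarrow> (\<forall>n\<in>A. k \<le> n)" for k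
    by (auto simp: not_less)
  ultimately show ?thesis
    by simp
qed

theorem theorem6:
  fixes Sets :: "'a::{linordered_idom, discrete_linordered_semidom} set set"
    and grossone \<kappa> :: 'a
    and A :: "'a set"
  assumes "grossone_system Sets grossone"
    and "0 < \<kappa>"
    and "A \<in> Sets"
    and "A \<subseteq> {1..\<kappa>}"
    and "A \<noteq> {}"
  shows "\<exists>\<mu>\<in>{1..\<kappa>}. \<mu> \<in> A \<and> (\<forall>n\<in>A. \<mu> \<le> n)"
proof -
  interpret grossone_system Sets grossone
    by fact
  let ?S = "{k \<in> {1..\<kappa>}. \<forall>n\<in>A. k \<le> n}"
  obtain a where "a \<in> A"
    using assms(5) by blast
  \<comment> \<open>The element \<open>a\<close> gives 1 \<le> \<kappa>. This membership also makes
    \<open>{1..\<sigma>}\<close> nonempty below, so that \<sigma> itself lies in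
    \<open>?S\<close>.\<close>
  have "1 \<in> ?S"
    using assms(4) \<open>a \<in> A\<close> by (auto intro: order_trans)
  have "initial_segment \<kappa> ?S"
    unfolding initial_segment_def
  proof (intro conjI ballI allI impI)
    show "y \<in> ?S" if "x \<in> ?S" "1 \<le> y \<and> y < x" for x y
      using that by (auto intro: order_trans[OF less_imp_le])
  qed (use \<open>1 \<in> ?S\<close> in blast)+
  then obtain \<sigma> where \<sigma>: "?S = {1..\<sigma>}"
    using initial_segment_axiom[OF assms(2) lower_bounds_in_Sets[OF assms(2,3)]] by blast
  with \<open>1 \<in> ?S\<close> have "\<sigma> \<in> ?S"
    by (metis atLeastAtMost_iff order_refl)
  moreover have "\<sigma> \<in> A"
  proof (rule ccontr)
    assume "\<sigma> \<notin> A"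
    \<comment> \<open>Discreteness of the order turns \<sigma> < n into \<sigma> + 1 \<le>
      n.\<close>
    have bound: "\<sigma> + 1 \<le> n" if "n \<in> A" for n
    proof -
      have "\<sigma> \<le> n"
        using \<open>\<sigma> \<in> ?S\<close> that by blast
      moreover have "\<sigma> \<noteq> n"
        using \<open>\<sigma> \<notin> A\<close> that by blast
      ultimately show ?thesis
        using less_iff_succ_less_eq[of \<sigma> n] by simp
    qed
    \<comment> \<open>Since \<sigma> + 1 \<le> a \<le> \<kappa>, the new lower bound stays inside
      \<open>{1..\<kappa>}\<close>.\<close>
    have "\<sigma> + 1 \<le> \<kappa>"
      using order_trans[OF bound[OF \<open>a \<in> A\<close>]] assms(4) \<open>a \<in> A\<close> by auto
    moreover have "1 \<le> \<sigma> + 1"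
      using \<open>\<sigma> \<in> ?S\<close> by (auto intro: order_trans)
    ultimately have "\<sigma> + 1 \<in> ?S"
      using bound by simp
    then show False
      unfolding \<sigma> by simp
  qed
  ultimately show ?thesis
    by blast
qed

end
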